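(* Let $\mathcal{C}\subset\mathbb{R}^d$ be a nonempty compact convex set, $f$ a convex differentiable function on $\mathcal{C}$, $f^*=\min_{x\in\mathcal{C}}f(x)$, and $x_0\in\mathcal{C}$ with $f(x_0)>f^*$. For $x\in\mathcal{C}$ let $v(x)\in\operatorname{argmin}_{v\in\mathcal{C}}\langle\nabla f(x),v\rangle$ and $\delta(x)=v(x)-x$. Assume that $f$ is modified directionally smooth with direction function $\delta$ and constant $\tilde{\mathcal{L}}_{f,\delta}(x_0)>0$. Let $(x_k)_{k\ge0}$ be the iterates of the Frank-Wolfe algorithm $x_{k+1}=x_k+h_k\delta(x_k)$ started at $x_0$, where either the step size is $$h_k=\min\Big\{1,\;\frac{1}{\tilde{\mathcal{L}}_{f,\delta}(x_0)}\sqrt{\frac{f(x_k)-f^*}{f(x_0)-f^*}}\Big\}\quad\text{for all }k,$$ or $h_k\in\operatorname{argmin}_{h\in[0,1]}f(x_k+h\delta(x_k))$ for all $k$ (exact line-search). Then $$f(x_k)-f^*\le\frac{4\,(f(x_0)-f^* )\max\{1,\;18\,\tilde{\mathcal{L}}_{f,\delta}^2(x_0)\}}{(k+2)^2}\qquad\text{for all }k\ge0.$$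
   Context: Given $x_0\in\mathcal{C}$, $f$ is modified directionally smooth with direction function $\delta:\mathcal{C}\to\mathbb{R}^d$ and constant $\tilde{\mathcal{L}}_{f,\delta}(x_0)>0$ if for all $x\in\mathcal{C}$ with $f(x)>f^*$ and all $0<h<1$, $$f(x+h\delta(x))\le f(x)+h\langle\nabla f(x),\delta(x)\rangle-\frac{\tilde{\mathcal{L}}_{f,\delta}(x_0)\,h^2}{2}\langle\nabla f(x),\delta(x)\rangle\sqrt{\frac{f(x_0)-f^*}{f(x)-f^*}},$$ where $f^*=\min_{\mathcal{C}}f$. *)

theory Defs
  imports "HOL-Analysis.Analysis"
begin

text \<open>The value \<open>min\<^sub>C f\<close>. It is meaningful only where the minimum is attained; this is the case for
  \<open>f\<close> continuous on a nonempty compact set \<open>C\<close>.\<close>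

definition min_val :: "('a \<Rightarrow> real) \<Rightarrow> 'a set \<Rightarrow> real" where
  "min_val f C = f (arg_min_on f C)"

text \<open>\<open>g\<close> is a gradient of \<open>f\<close> on \<open>C\<close>. Derivatives are taken within \<open>C\<close>, so nothing is asked of \<open>f\<close>
  outside \<open>C\<close>; the gradient of a function differentiable on a neighbourhood of \<open>C\<close> qualifies.
  If \<open>C\<close> is convex with empty interior, \<open>g x\<close> is unique only up to vectors orthogonal to \<open>C - x\<close>.
  For convex \<open>C\<close> this does not affect the products \<open>g x \<bullet> (y - x)\<close> with \<open>y \<in> C\<close>, nor the minimisers
  of \<open>v \<mapsto> g x \<bullet> v\<close> over \<open>C\<close>.\<close>

definition is_gradient_on ::
    "('a::real_inner \<Rightarrow> 'a) \<Rightarrow> ('a \<Rightarrow> real) \<Rightarrow> 'a set \<Rightarrow> bool" where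
  "is_gradient_on g f C \<longleftrightarrow> (\<forall>x\<in>C. (f has_derivative (\<lambda>v. g x \<bullet> v)) (at x within C))"

definition modified_directionally_smooth ::
    "'a::real_inner set \<Rightarrow> ('a \<Rightarrow> real) \<Rightarrow> ('a \<Rightarrow> 'a) \<Rightarrow> 'a \<Rightarrow> ('a \<Rightarrow> 'a) \<Rightarrow> real \<Rightarrow> bool" where
  "modified_directionally_smooth C f g x0 \<delta> L \<longleftrightarrow>
     L > 0 \<and>
     (\<forall>x\<in>C. \<forall>h. f x > min_val f C \<longrightarrow> 0 < h \<longrightarrow> h < 1 \<longrightarrow>
        f (x + h *\<^sub>R \<delta> x) \<le> f x + h * (g x \<bullet> \<delta> x)
          - L * h\<^sup>2 / 2 * (g x \<bullet> \<delta> x) * sqrt ((f x0 - min_val f C) / (f x - min_val f C)))"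

end

theory Submission
  imports Defs
begin

text \<open>
  Why the rate is quadratic: let \<open>s\<^sub>k = sqrt ((f (x\<^sub>k) - f\<^sup>*) / (f (x\<^sub>0) - f\<^sup>*))\<close>, so that \<open>s\<^sub>0 = 1\<close>. By
  convexity the Frank-Wolfe gap \<open>- g x \<bullet> \<delta> x\<close> dominates \<open>f x - f\<^sup>*\<close>
  (\<open>gap_ge_suboptimality\<close>). The second-order term in the smoothness inequality is a multiple of
  the same gap, so for the step size \<open>t = min 1 (s/L)\<close>, which minimises the smoothness bound over
  \<open>[0,1]\<close>, the gap can be replaced by \<open>f x - f\<^sup>*\<close> in both terms. This gives
  \<open>s\<^sub>k\<^sub>+\<^sub>1\<^sup>2 \<le> s\<^sub>k\<^sup>2 (1 - t + L t\<^sup>2 / (2 s\<^sub>k))\<close> (\<open>short_step_decrease\<close>). Exact line search does at least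
  as well as any fixed step size in \<open>[0,1]\<close>, hence obeys the same inequality.

  For a short step \<open>t = s\<^sub>k/L\<close> the factor is \<open>1 - s\<^sub>k/(2L)\<close>, that is, \<open>s\<^sub>k\<^sub>+\<^sub>1\<close> is roughly
  \<open>s\<^sub>k - s\<^sub>k\<^sup>2/(4L)\<close>, which makes \<open>1/s\<^sub>k\<close> grow linearly. Precisely, for any \<open>M \<ge> max 1 (4L)\<close> both the
  short and the full step satisfy \<open>s\<^sub>k\<^sub>+\<^sub>1 \<le> M s\<^sub>k / (M + s\<^sub>k)\<close> (\<open>short_step_harmonic\<close>), that is,
  \<open>1/s\<^sub>k\<^sub>+\<^sub>1 \<ge> 1/s\<^sub>k + 1/M\<close> as long as the minimum is not reached, whence
  \<open>s\<^sub>k \<le> M/(k+1)\<close> by induction. With \<open>M\<^sup>2 = max 1 (18 L\<^sup>2)\<close> and \<open>1/(k+1) \<le> 2/(k+2)\<close>, squaring gives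
  the claim.
\<close>

section \<open>Minima and the Frank-Wolfe gap\<close>

lemma arg_min_on_is_arg_min:
  fixes f :: "'a::topological_space \<Rightarrow> real"
  assumes "compact C" "continuous_on C f" "C \<noteq> {}"
  shows "is_arg_min f (\<lambda>w. w \<in> C) (arg_min_on f C)"
proof -
  obtain z where "z \<in> C" "\<forall>w\<in>C. f z \<le> f w"
    using continuous_attains_inf[of C f] assms by blast
  then have "is_arg_min f (\<lambda>w. w \<in> C) z"
    by (auto simp: is_arg_min_linorder)
  then show ?thesis
    unfolding arg_min_on_def arg_min_def by (rule someI)
qed

lemma min_val_le:
  fixes f :: "'a::topological_space \<Rightarrow> real"
  assumes "compact C" "continuous_on C f" "y \<in> C"
  shows "min_val f C \<le> f y"
  using arg_min_on_is_arg_min[of C f] assms by (auto simp: min_val_def is_arg_min_linorder)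

lemma min_val_attained:
  fixes f :: "'a::topological_space \<Rightarrow> real"
  assumes "compact C" "continuous_on C f" "C \<noteq> {}"
  obtains z where "z \<in> C" "f z = min_val f C"
  using arg_min_on_is_arg_min[OF assms] that by (auto simp: min_val_def is_arg_min_linorder)

lemma is_gradient_on_imp_continuous_on:
  "is_gradient_on g f C \<Longrightarrow> continuous_on C f"
  unfolding is_gradient_on_def continuous_on_eq_continuous_within
  using has_derivative_continuous by blast

lemma convex_segment_in:
  assumes "convex C" "x \<in> C" "y \<in> C" "0 \<le> t" "t \<le> 1"
  shows "x + t *\<^sub>R (y - x) \<in> C"
proof -
  have "(1 - t) *\<^sub>R x + t *\<^sub>R y \<in> C"
    using assms by (intro convexD) auto
  then show ?thesis by (simp add: algebra_simps)
qed

text \<open>The slope of the secant of \<open>f\<close> from \<open>x\<close> towards \<open>y\<close> is at most \<open>f y - f x\<close>; as the secant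
  shrinks to \<open>x\<close>, its slope converges to the derivative along the segment.\<close>

lemma convex_gradient_below:
  fixes f :: "'a::real_inner \<Rightarrow> real"
  assumes "convex_on C f" "is_gradient_on g f C" "x \<in> C" "y \<in> C"
  shows "f x + g x \<bullet> (y - x) \<le> f y"
proof -
  let ?p = "\<lambda>t::real. x + t *\<^sub>R (y - x)"
  have conv: "convex C" using assms(1) by (rule convex_on_imp_convex)
  have sub: "?p ` {0..1} \<subseteq> C"
    using convex_segment_in[OF conv assms(3,4)] by auto
  have "(f has_derivative (\<lambda>w. g x \<bullet> w)) (at (?p 0) within ?p ` {0..1})"
    using assms(2,3) sub unfolding is_gradient_on_def
    by (auto intro: has_derivative_subset)
  moreover have "(?p has_derivative (\<lambda>t. t *\<^sub>R (y - x))) (at 0 within {0..1})"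
    by (auto intro!: derivative_eq_intros)
  ultimately have "((\<lambda>t. f (?p t)) has_derivative (\<lambda>t. g x \<bullet> (t *\<^sub>R (y - x)))) (at 0 within {0..1})"
    by (rule has_derivative_in_compose[rotated])
  then have "((\<lambda>t. f (?p t)) has_real_derivative g x \<bullet> (y - x)) (at 0 within {0..1})"
    by (simp add: has_field_derivative_def mult_commute_abs)
  then have lim: "((\<lambda>t. (f (?p t) - f x) / t) \<longlongrightarrow> g x \<bullet> (y - x)) (at 0 within {0..1})"
    by (simp add: has_field_derivative_iff)
  have "g x \<bullet> (y - x) \<le> f y - f x"
  proof (rule tendsto_upperbound[OF lim])
    have "(f (?p t) - f x) / t \<le> f y - f x" if "0 < t" "t \<le> 1" for t
    proof -
      have "f ((1 - t) *\<^sub>R x + t *\<^sub>R y) \<le> (1 - t) * f x + t * f y"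
        using convex_onD[OF assms(1), of t x y] that assms by auto
      then have "f (?p t) - f x \<le> t * (f y - f x)"
        by (simp add: algebra_simps)
      with that show ?thesis by (simp add: field_simps)
    qed
    then show "\<forall>\<^sub>F t in at 0 within {0..1}. (f (?p t) - f x) / t \<le> f y - f x"
      by (auto simp: eventually_at_filter)
    show "at (0::real) within {0..1} \<noteq> bot"
      by (simp add: at_within_Icc_at_right)
  qed
  then show ?thesis by simp
qed

text \<open>Bound \<open>f\<close> from below by its linearisation at \<open>x\<close>, evaluated at a minimiser of \<open>f\<close>; no point
  of \<open>C\<close> makes the linearisation smaller than \<open>v\<close> does.\<close>

lemma gap_ge_suboptimality:
  fixes f :: "'a::real_inner \<Rightarrow> real"
  assumes "compact C" "convex_on C f" "is_gradient_on g f C" "x \<in> C"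
    and "is_arg_min (\<lambda>w. g x \<bullet> w) (\<lambda>w. w \<in> C) v"
  shows "f x - min_val f C \<le> - (g x \<bullet> (v - x))"
proof -
  obtain z where z: "z \<in> C" "f z = min_val f C"
    using min_val_attained assms(1,4) is_gradient_on_imp_continuous_on[OF assms(3)] by blast
  have "f x + g x \<bullet> (z - x) \<le> f z"
    using convex_gradient_below assms z by blast
  moreover have "g x \<bullet> v \<le> g x \<bullet> z"
    using assms(5) z by (simp add: is_arg_min_linorder)
  ultimately show ?thesis using z by (simp add: inner_diff_right)
qed

section \<open>Decrease in one step\<close>

text \<open>The smoothness inequality is required only for \<open>0 < h < 1\<close>; continuity of \<open>f\<close> extends it to the
  end points, of which \<open>h = 1\<close> is the full Frank-Wolfe step.\<close>

lemma modified_directionally_smooth_closed: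
  fixes f :: "'a::real_inner \<Rightarrow> real"
  assumes smooth: "modified_directionally_smooth C f g x0 \<delta> L"
    and cont: "continuous_on C f" and "convex C"
    and "x \<in> C" "x + \<delta> x \<in> C" "f x > min_val f C" "t \<in> {0..1}"
  shows "f (x + t *\<^sub>R \<delta> x) \<le> f x + t * (g x \<bullet> \<delta> x)
          - L * t\<^sup>2 / 2 * (g x \<bullet> \<delta> x) * sqrt ((f x0 - min_val f C) / (f x - min_val f C))"
proof -
  let ?q = "\<lambda>t. f x + t * (g x \<bullet> \<delta> x)
          - L * t\<^sup>2 / 2 * (g x \<bullet> \<delta> x) * sqrt ((f x0 - min_val f C) / (f x - min_val f C))"
  let ?e = "\<lambda>t. ?q t - f (x + t *\<^sub>R \<delta> x)"
  have seg: "x + t *\<^sub>R \<delta> x \<in> C" if "t \<in> {0..1}" for t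
    using convex_segment_in[of C x "x + \<delta> x" t] that assms by simp
  have cl: "closure {0<..<1::real} = {0..1}" by simp
  have "continuous_on {0..1} (\<lambda>t. f (x + t *\<^sub>R \<delta> x))"
    using seg by (intro continuous_on_compose2[OF cont] continuous_intros) auto
  then have c: "continuous_on (closure {0<..<1}) ?e"
    unfolding cl by (intro continuous_intros) auto
  have "0 \<le> ?e t"
  proof (rule continuous_ge_on_closure[OF c])
    show "t \<in> closure {0<..<1}" using assms by simp
    show "0 \<le> ?e u" if "u \<in> {0<..<1}" for u
      using smooth that assms unfolding modified_directionally_smooth_def by auto
  qed
  then show ?thesis by simp
qed

text \<open>The bound on \<open>t\<close> makes the total coefficient of the gap nonpositive, so that the gap may be
  replaced by its lower bound \<open>f x - f\<^sup>*\<close>.\<close>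

lemma short_step_decrease:
  fixes f :: "'a::real_inner \<Rightarrow> real"
  assumes smooth: "modified_directionally_smooth C f g x0 \<delta> L"
    and "compact C" "convex_on C f" and grad: "is_gradient_on g f C"
    and "f x0 > min_val f C"
    and x: "x \<in> C" "f x > min_val f C"
    and v: "is_arg_min (\<lambda>w. g x \<bullet> w) (\<lambda>w. w \<in> C) v" and "\<delta> x = v - x"
    and s: "s = sqrt ((f x - min_val f C) / (f x0 - min_val f C))"
    and t: "0 \<le> t" "t \<le> 1" "L * t \<le> s"
  shows "f (x + t *\<^sub>R \<delta> x) - min_val f C
           \<le> (f x - min_val f C) * (1 - t + L * t\<^sup>2 / (2 * s))"
proof -
  define G where "G = - (g x \<bullet> \<delta> x)"
  have G: "f x - min_val f C \<le> G"
    unfolding G_def using gap_ge_suboptimality[of C f g x v] assms by simp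
  have L: "L > 0" using smooth by (simp add: modified_directionally_smooth_def)
  have s0: "s > 0" using assms by simp
  have r: "sqrt ((f x0 - min_val f C) / (f x - min_val f C)) = 1 / s"
    unfolding s by (simp add: real_sqrt_divide)
  have "v \<in> C" using v by (simp add: is_arg_min_linorder)
  then have "f (x + t *\<^sub>R \<delta> x) \<le> f x + t * (g x \<bullet> \<delta> x) - L * t\<^sup>2 / 2 * (g x \<bullet> \<delta> x) * (1 / s)"
    using modified_directionally_smooth_closed[OF smooth is_gradient_on_imp_continuous_on[OF grad]
        convex_on_imp_convex[OF \<open>convex_on C f\<close>], of x t] assms(9) x t
    unfolding r by simp
  also have "\<dots> = f x - G * (t - L * t\<^sup>2 / (2 * s))"
    unfolding G_def by (simp add: field_simps)
  finally have 1: "f (x + t *\<^sub>R \<delta> x) \<le> f x - G * (t - L * t\<^sup>2 / (2 * s))" .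
  have "L * t\<^sup>2 / (2 * s) = t * (L * t / (2 * s))" by (simp add: power2_eq_square)
  also have "\<dots> \<le> t * 1"
    using t s0 by (intro mult_left_mono) auto
  finally have "(f x - min_val f C) * (t - L * t\<^sup>2 / (2 * s)) \<le> G * (t - L * t\<^sup>2 / (2 * s))"
    using G by (intro mult_right_mono) auto
  with 1 show ?thesis by (simp add: algebra_simps)
qed

text \<open>The right-hand side is the square of the harmonic recursion \<open>1/s' = 1/s + 1/M\<close>. With
  \<open>u = s/M\<close>, a short step has factor at most \<open>1 - 2u \<le> 1/(1+u)\<^sup>2\<close>; a full step has factor
  \<open>L/(2s)\<close>, where \<open>L\<close> is small against both \<open>s\<close> and \<open>M\<close>: expanding \<open>L (M+s)\<^sup>2\<close>, the leading term
  uses \<open>L \<le> s\<close> and the others use \<open>L \<le> M/4\<close>.\<close>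

lemma short_step_harmonic:
  fixes s L M t :: real
  assumes "0 < s" "s \<le> M" "0 < L" "4 * L \<le> M" and t: "t = min 1 (s / L)"
  shows "s\<^sup>2 * (1 - t + L * t\<^sup>2 / (2 * s)) \<le> (M * s / (M + s))\<^sup>2"
proof (cases "L \<le> s")
  case True
  then have t1: "t = 1" using assms by simp
  have 1: "L * (M * M) \<le> s * (M * M)" using True by (simp add: mult_right_mono)
  have 2: "4 * L * (M * s) \<le> M * (M * s)" using assms by (intro mult_right_mono) auto
  have 3: "4 * L * (s * s) \<le> M * (M * s)" using assms by (intro mult_mono) auto
  have 4: "0 \<le> M * (M * s)" using assms by simp
  have "L * (M + s)\<^sup>2 = L * (M * M) + 2 * (L * (M * s)) + L * (s * s)"
    by (simp add: power2_eq_square algebra_simps)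
  also have "\<dots> \<le> 2 * (M * (M * s))"
    using 1 2 3 4 by (simp add: algebra_simps)
  finally have "L * (M + s)\<^sup>2 \<le> 2 * M\<^sup>2 * s"
    by (simp add: power2_eq_square)
  then have "s * (L * (M + s)\<^sup>2) \<le> s * (2 * M\<^sup>2 * s)"
    using assms by (intro mult_left_mono) auto
  then have "s * L / 2 * (M + s)\<^sup>2 \<le> (M * s)\<^sup>2"
    by (simp add: power2_eq_square mult_ac)
  moreover have "0 < (M + s)\<^sup>2" using assms by simp
  ultimately have "s * L / 2 \<le> (M * s)\<^sup>2 / (M + s)\<^sup>2"
    by (simp only: pos_le_divide_eq)
  moreover have "s\<^sup>2 * (1 - t + L * t\<^sup>2 / (2 * s)) = s * L / 2"
    using assms t1 by (simp add: power2_eq_square)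
  ultimately show ?thesis by (simp only: power_divide)
next
  case False
  then have t1: "t = s / L" using assms by simp
  define u where "u = s / M"
  have M: "0 < M" using assms by linarith
  have u: "0 \<le> u" "s = M * u" using assms M by (auto simp: u_def)
  have "2 * u \<le> s / (2 * L)"
    using assms M by (simp add: u_def field_simps)
  then have "1 - s / (2 * L) \<le> 1 - 2 * u" by simp
  also have "\<dots> \<le> 1 / (1 + u)\<^sup>2"
  proof -
    have "(1 - 2 * u) * (1 + u)\<^sup>2 = 1 - (3 * u\<^sup>2 + 2 * u ^ 3)"
      by (simp add: power2_eq_square power3_eq_cube algebra_simps)
    also have "\<dots> \<le> 1"
    proof -
      have "0 \<le> u\<^sup>2" "0 \<le> u ^ 3" using u by simp_all
      then show ?thesis by linarith
    qed
    finally show ?thesis using u by (simp add: pos_le_divide_eq)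
  qed
  finally have "s\<^sup>2 * (1 - s / (2 * L)) \<le> s\<^sup>2 * (1 / (1 + u)\<^sup>2)"
    by (intro mult_left_mono) auto
  also have "\<dots> = (s / (1 + u))\<^sup>2" by (simp add: power_divide)
  also have "s / (1 + u) = M * s / (M + s)" using assms M by (simp add: u_def field_simps)
  also have "s\<^sup>2 * (1 - s / (2 * L)) = s\<^sup>2 * (1 - t + L * t\<^sup>2 / (2 * s))"
    unfolding t1 using assms(1,3) by (simp add: power2_eq_square field_simps)
  finally show ?thesis .
qed

lemma harmonic_step_bound:
  fixes s M :: real
  assumes "0 \<le> s" "0 < M" "s \<le> M / (real k + 1)"
  shows "M * s / (M + s) \<le> M / (real (Suc k) + 1)"
proof -
  have "s * (real k + 1) \<le> M" using assms by (simp add: pos_le_divide_eq)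
  then have "M * (s * (real k + 2)) \<le> M * (M + s)"
    using assms by (intro mult_left_mono) (auto simp: algebra_simps)
  then show ?thesis using assms by (simp add: field_simps)
qed

section \<open>The convergence rate\<close>

theorem theoremD2:
  fixes C :: "(real ^ 'd) set"
    and f :: "real ^ 'd \<Rightarrow> real"
    and g v \<delta> :: "real ^ 'd \<Rightarrow> real ^ 'd"
    and x0 :: "real ^ 'd"
    and L :: real
    and x :: "nat \<Rightarrow> real ^ 'd"
    and h :: "nat \<Rightarrow> real"
  assumes "C \<noteq> {}" and "compact C" and "convex C"
    and "convex_on C f"
    and "is_gradient_on g f C"
    and "x0 \<in> C" and "f x0 > min_val f C"
    and "\<And>y. y \<in> C \<Longrightarrow> is_arg_min (\<lambda>w. g y \<bullet> w) (\<lambda>w. w \<in> C) (v y)"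
    and "\<And>y. y \<in> C \<Longrightarrow> \<delta> y = v y - y"
    and "modified_directionally_smooth C f g x0 \<delta> L"
    and "x 0 = x0"
    and "\<And>k. x (Suc k) = x k + h k *\<^sub>R \<delta> (x k)"
    and "(\<forall>k. h k = min 1 (1 / L * sqrt ((f (x k) - min_val f C) / (f x0 - min_val f C))))
       \<or> (\<forall>k. is_arg_min (\<lambda>t. f (x k + t *\<^sub>R \<delta> (x k))) (\<lambda>t. t \<in> {0..1}) (h k))"
  shows "\<forall>k. f (x k) - min_val f C
           \<le> 4 * (f x0 - min_val f C) * max 1 (18 * L\<^sup>2) / (real k + 2)\<^sup>2"
proof -
  note conv = \<open>convex C\<close> and grad = \<open>is_gradient_on g f C\<close>
    and smooth = \<open>modified_directionally_smooth C f g x0 \<delta> L\<close>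
  define m where "m = min_val f C"
  define D where "D = f x0 - m"
  define s where "s k = sqrt ((f (x k) - m) / D)" for k
  define M where "M = sqrt (max 1 (18 * L\<^sup>2))"
  have D: "D > 0" using assms(7) by (simp add: D_def m_def)
  have L: "L > 0" using smooth by (simp add: modified_directionally_smooth_def)
  have M2: "M\<^sup>2 = max 1 (18 * L\<^sup>2)" by (simp add: M_def)
  have M1: "M \<ge> 1" by (simp add: M_def)
  have M4: "4 * L \<le> M"
    unfolding M_def by (rule real_le_rsqrt) (simp add: power_mult_distrib max.coboundedI2)
  have cont: "continuous_on C f" using grad by (rule is_gradient_on_imp_continuous_on)
  have m_le: "m \<le> f y" if "y \<in> C" for y
    unfolding m_def using min_val_le[OF \<open>compact C\<close> cont that] .
  have step_in: "y + t *\<^sub>R \<delta> y \<in> C" if "y \<in> C" "0 \<le> t" "t \<le> 1" for y t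
    using convex_segment_in[OF conv that(1), of "v y" t] assms(8)[OF that(1)] assms(9)[OF that(1)] that
    by (simp add: is_arg_min_linorder)
  have h01: "0 \<le> h k \<and> h k \<le> 1" if "x k \<in> C" for k
    using assms(13) m_le[OF that] D L
    by (auto simp: is_arg_min_linorder m_def D_def)
  have xC: "x k \<in> C" for k
    by (induction k) (use assms h01 step_in in auto)
  have s0: "0 \<le> s k" and s2: "f (x k) - m = D * (s k)\<^sup>2" for k
    using m_le[OF xC] D by (simp_all add: s_def)
  \<comment> \<open>The explicit step size lies in \<open>[0,1]\<close>, so it competes in the line search.\<close>
  have next_le: "f (x (Suc k)) \<le> f (x k + min 1 (s k / L) *\<^sub>R \<delta> (x k))" for k
    using assms(13)
  proof
    assume "\<forall>k. h k = min 1 (1 / L * sqrt ((f (x k) - min_val f C) / (f x0 - min_val f C)))"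
    then have "h k = min 1 (s k / L)" by (simp add: s_def m_def D_def)
    then show ?thesis by (simp add: assms(12))
  next
    assume "\<forall>k. is_arg_min (\<lambda>t. f (x k + t *\<^sub>R \<delta> (x k))) (\<lambda>t. t \<in> {0..1}) (h k)"
    then show ?thesis using s0[of k] L by (simp add: is_arg_min_linorder assms(12))
  qed
  have rate: "s k \<le> M / (real k + 1)" for k
  proof (induction k)
    case 0
    then show ?case using M1 D by (simp add: s_def D_def \<open>x 0 = x0\<close>)
  next
    case (Suc k)
    have "s k * 1 \<le> s k * (real k + 1)" by (intro mult_left_mono s0) simp
    also have "\<dots> \<le> M" using Suc by (simp add: pos_le_divide_eq)
    finally have sM: "s k \<le> M" by simp
    have "(s (Suc k))\<^sup>2 \<le> (M * s k / (M + s k))\<^sup>2"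
    proof (cases "s k = 0")
      case True
      then have "f (x (Suc k)) \<le> f (x k)" using next_le[of k] L by simp
      then have "D * (s (Suc k))\<^sup>2 \<le> 0" using s2[of k] s2[of "Suc k"] True by simp
      then show ?thesis using D True by (simp add: mult_le_0_iff)
    next
      case False
      then have sp: "0 < s k" using s0[of k] by simp
      define t where "t = min 1 (s k / L)"
      have t: "0 \<le> t" "t \<le> 1" "L * t \<le> s k"
        using sp L by (auto simp: t_def min_def field_simps)
      have "0 < D * (s k)\<^sup>2" using sp D by simp
      then have "f (x k) > m" unfolding s2[symmetric] by simp
      then have "f (x k + t *\<^sub>R \<delta> (x k)) - m \<le> (f (x k) - m) * (1 - t + L * t\<^sup>2 / (2 * s k))"
        unfolding m_def
        by (intro short_step_decrease[OF smooth \<open>compact C\<close> \<open>convex_on C f\<close> grad assms(7) xC _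
            assms(8)[OF xC] assms(9)[OF xC] _ t]) (simp_all add: s_def m_def D_def)
      then have "D * (s (Suc k))\<^sup>2 \<le> D * ((s k)\<^sup>2 * (1 - t + L * t\<^sup>2 / (2 * s k)))"
        using next_le[of k] s2[of k] s2[of "Suc k"] by (simp add: t_def mult.assoc)
      then have "(s (Suc k))\<^sup>2 \<le> (s k)\<^sup>2 * (1 - t + L * t\<^sup>2 / (2 * s k))"
        using D by (simp only: mult_le_cancel_left_pos)
      also have "\<dots> \<le> (M * s k / (M + s k))\<^sup>2"
        by (rule short_step_harmonic[OF sp sM L M4 t_def])
      finally show ?thesis .
    qed
    then have "s (Suc k) \<le> M * s k / (M + s k)"
      by (rule power2_le_imp_le) (use s0[of k] M1 in simp)
    also have "\<dots> \<le> M / (real (Suc k) + 1)"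
      using harmonic_step_bound s0 M1 Suc by simp
    finally show ?case .
  qed
  show ?thesis
  proof
    fix k
    have "s k \<le> M / (real k + 1)" by (rule rate)
    also have "\<dots> \<le> 2 * M / (real k + 2)" using M1 by (simp add: field_simps)
    finally have "(s k)\<^sup>2 \<le> (2 * M / (real k + 2))\<^sup>2" using s0 by (rule power_mono)
    also have "\<dots> = 4 * M\<^sup>2 / (real k + 2)\<^sup>2" by (simp add: power_divide power_mult_distrib)
    finally have "D * (s k)\<^sup>2 \<le> D * (4 * M\<^sup>2 / (real k + 2)\<^sup>2)"
      using D by (intro mult_left_mono) auto
    then show "f (x k) - min_val f C
           \<le> 4 * (f x0 - min_val f C) * max 1 (18 * L\<^sup>2) / (real k + 2)\<^sup>2"
      unfolding s2[symmetric] M2 by (simp only: D_def m_def times_divide_eq_right mult_ac)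
  qed
qed

end
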